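(* Let $n\ge2$. Then for any finite set $C$, the number of transitive maps $[n]\times[n]\to C$ (equivalently, of transitive $n\times n$ matrices with entries in $C$) equals $q_n(|C|)$, where $$q_n(x)=2x^n-x+\big(\tfrac12B_n-2^n+1\big)x(x-1),\qquad B_n=\sum_{1\le k\le n}\left\{{n\atop k}\right\}2^kk!.$$ In particular, the number of transitive maps $[n]\times[n]\to\{1,-1\}$ is $q_n(2)=B_n$.
   Context: $[n]=\{1,\dots,n\}$ and $\left\{{n\atop k}\right\}$ is the Stirling number of the second kind. A map $\mathbf c:[n]\times[n]\to C$ is transitive if $\mathbf c(i,k)\in\{\mathbf c(i,j),\mathbf c(j,k)\}$ for all $i,j,k\in[n]$ (not necessarily distinct). *)

theory Defs
  imports Complex_Main "HOL-Library.FuncSet" "HOL-Combinatorics.Stirling"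
begin

definition transitive_map :: "nat \<Rightarrow> (nat \<times> nat \<Rightarrow> 'c) \<Rightarrow> bool" where
  "transitive_map n c \<longleftrightarrow>
     (\<forall>i\<in>{1..n}. \<forall>j\<in>{1..n}. \<forall>k\<in>{1..n}. c (i, k) \<in> {c (i, j), c (j, k)})"

text \<open>Maps on the finite domain are represented by extensional functions, so that distinct
  elements of this set are distinct maps on the domain.\<close>

definition transitive_maps :: "nat \<Rightarrow> 'c set \<Rightarrow> (nat \<times> nat \<Rightarrow> 'c) set" where
  "transitive_maps n C = {c \<in> ({1..n} \<times> {1..n}) \<rightarrow>\<^sub>E C. transitive_map n c}"

definition B_num :: "nat \<Rightarrow> nat" where
  "B_num n = (\<Sum>k = 1..n. Stirling n k * 2 ^ k * fact k)"

definition q_fun :: "nat \<Rightarrow> real \<Rightarrow> real" where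
  "q_fun n x = 2 * x ^ n - x + (1 / 2 * real (B_num n) - 2 ^ n + 1) * x * (x - 1)"

end

(* A transitive map that is not a function of its first or of its second argument takes
   at most two values: if row i has two values and a third value occurs anywhere, then it
   occurs in row i, and a row with three values forces c (x, y) = c (i, y) for all x, y.
   Maps depending on one argument contribute 2 x^n - x, and the others are counted by the two
   values they take, so that the case of two values remains.  There, i is below j if
   c (i, j) = a and c (j, i) = b.  This is a strict weak order, and on each of its levels c is
   constant; so two-valued transitive maps correspond to surjections of [n] onto the levels
   {0, ..., k - 1} together with the set of those levels on which c is a. *)
theory Submission
  imports Defs
begin

section \<open>Surjections and Stirling numbers of the second kind\<close>

section \<open>Surjections\<close>

definition surjections :: "'a set \<Rightarrow> 'b set \<Rightarrow> ('a \<Rightarrow> 'b) set" where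
  "surjections A B = {f \<in> extensional A. f ` A = B}"

lemma finite_Collect_PiE:
  assumes "finite A" "finite B"
  shows "finite {f \<in> A \<rightarrow>\<^sub>E B. P f}"
  by (rule finite_subset[of _ "A \<rightarrow>\<^sub>E B"]) (use assms in \<open>auto intro!: finite_PiE\<close>)

lemma finite_surjections:
  assumes "finite A" "finite B"
  shows "finite (surjections A B)"
proof -
  have "surjections A B = {f \<in> A \<rightarrow>\<^sub>E B. f ` A = B}"
    by (auto simp: surjections_def PiE_def)
  with finite_Collect_PiE[OF assms] show ?thesis
    by simp
qed

text \<open>Deleting the point \<open>a\<close> from a surjection leaves a map that is still onto
  \<open>B\<close> or misses exactly the value \<open>b\<close> taken at \<open>a\<close>. These two
  cases become the two summands of the Stirling recurrence.\<close>

lemma bij_betw_surjections_insert: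
  assumes "a \<notin> A"
  shows "bij_betw (\<lambda>(b, f). f(a := b))
    (SIGMA b:B. surjections A B \<union> surjections A (B - {b})) (surjections (insert a A) B)"
\<comment> \<open>Resetting the value at \<open>a\<close> to \<open>undefined\<close> makes the
  remaining map extensional on \<open>A\<close>.\<close>
proof (rule bij_betw_byWitness[where f' = "\<lambda>f. (f a, f(a := undefined))"])
  show "\<forall>p\<in>SIGMA b:B. surjections A B \<union> surjections A (B - {b}).
      (\<lambda>f. (f a, f(a := undefined))) ((\<lambda>(b, f). f(a := b)) p) = p"
    using assms by (auto simp: surjections_def extensional_def fun_eq_iff)
  show "\<forall>f\<in>surjections (insert a A) B. (\<lambda>(b, f). f(a := b)) (f a, f(a := undefined)) = f"
    by simp
  show "(\<lambda>(b, f). f(a := b)) ` (SIGMA b:B. surjections A B \<union> surjections A (B - {b}))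
      \<subseteq> surjections (insert a A) B"
  proof safe
    fix b f assume b: "b \<in> B"
    have im: "(f(a := b)) ` insert a A = insert b (f ` A)"
      using assms by auto
    show "f(a := b) \<in> surjections (insert a A) B" if "f \<in> surjections A B"
      using that b im by (auto simp: surjections_def extensional_def)
    show "f(a := b) \<in> surjections (insert a A) B" if "f \<in> surjections A (B - {b})"
      using that b im by (auto simp: surjections_def extensional_def)
  qed
  show "(\<lambda>f. (f a, f(a := undefined))) ` surjections (insert a A) B
      \<subseteq> (SIGMA b:B. surjections A B \<union> surjections A (B - {b}))"
  proof (rule image_subsetI)
    fix f assume f: "f \<in> surjections (insert a A) B"
    have im: "(f(a := undefined)) ` A = f ` A"
      using assms by auto
    have "insert (f a) (f ` A) = B"
      using f by (simp add: surjections_def)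
    then have "f ` A = B \<or> f ` A = B - {f a}"
      by blast
    then show "(f a, f(a := undefined)) \<in> (SIGMA b:B. surjections A B \<union> surjections A (B - {b}))"
      using f im by (auto simp: surjections_def extensional_def)
  qed
qed

text \<open>A surjection is a partition of \<open>A\<close> into \<open>card B\<close> blocks
  together with a labelling of the blocks. The induction keeps \<open>B\<close> arbitrary because
  deleting a point may replace \<open>B\<close> by \<open>B - {b}\<close>.\<close>

lemma card_surjections:
  assumes "finite A" "finite B"
  shows "card (surjections A B) = fact (card B) * Stirling (card A) (card B)"
  using assms
proof (induction A arbitrary: B rule: finite_induct)
  case empty
  show ?case
  proof (cases "B = {}")
    case True
    then have "surjections ({} :: 'a set) B = {\<lambda>_. undefined}"
      by (auto simp: surjections_def)
    with True show ?thesis by simp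
  next
    case False
    then have "surjections ({} :: 'a set) B = {}"
      by (auto simp: surjections_def)
    moreover obtain k where "card B = Suc k"
      using False empty.prems by (metis card_0_eq not0_implies_Suc)
    ultimately show ?thesis by simp
  qed
next
  case (insert a A)
  have fin: "finite (surjections A D)" if "D \<subseteq> B" for D
    using finite_surjections insert that by (metis finite_subset)
  have disj: "surjections A B \<inter> surjections A (B - {b}) = {}" if "b \<in> B" for b
    using that by (auto simp: surjections_def)
  have "card (surjections (insert a A) B) =
      card (SIGMA b:B. surjections A B \<union> surjections A (B - {b}))"
    using bij_betw_surjections_insert[OF insert.hyps(2)] by (metis bij_betw_same_card)
  also have "\<dots> = (\<Sum>b\<in>B. card (surjections A B \<union> surjections A (B - {b})))"
    using fin insert.prems by (subst card_SigmaI) auto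
  also have "\<dots> = (\<Sum>b\<in>B. card (surjections A B) + card (surjections A (B - {b})))"
    using fin disj by (intro sum.cong refl card_Un_disjoint) auto
  also have "\<dots> = (\<Sum>b\<in>B. fact (card B) * Stirling (card A) (card B)
      + fact (card B - 1) * Stirling (card A) (card B - 1))"
    using insert.prems by (intro sum.cong refl) (simp add: insert.IH)
  also have "\<dots> = card B * (fact (card B) * Stirling (card A) (card B)
      + fact (card B - 1) * Stirling (card A) (card B - 1))"
    by simp
  \<comment> \<open>For positive \<open>card B\<close> this is the Stirling recurrence times
    \<open>fact (card B)\<close>; for \<open>card B = 0\<close>, where \<open>card B - 1\<close> is
    truncated, both sides are 0.\<close>
  also have "\<dots> = fact (card B) * Stirling (card (insert a A)) (card B)"
    using insert.hyps by (cases "card B") (simp_all add: algebra_simps)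
  finally show ?case .
qed

section \<open>Two-valued transitive maps as strict weak orders with marked levels\<close>

section \<open>Two values\<close>

text \<open>Since \<open>f\<close> skips no value, some chain of elements ending in \<open>i\<close>
  has \<open>f\<close>-values 0, 1, ..., \<open>f i\<close>, and \<open>g\<close> increases strictly
  along it. Used in both directions, this shows that a surjection onto an initial segment is
  determined by the order it induces.\<close>

lemma surjection_le_of_order_preserving:
  fixes f g :: "'a \<Rightarrow> nat"
  assumes "f ` A = {..<k}" and "\<And>i j. i \<in> A \<Longrightarrow> j \<in> A \<Longrightarrow> f i < f j \<Longrightarrow> g i < g j" and "i \<in> A"
  shows "f i \<le> g i"
  using \<open>i \<in> A\<close>
proof (induction "f i" arbitrary: i)
  case 0
  then show ?case by simp
next
  case (Suc m)
  have "m \<in> f ` A"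
    using Suc assms(1) by (metis imageI lessThan_iff less_trans lessI)
  then obtain j where j: "j \<in> A" "f j = m"
    by blast
  then have "m \<le> g j"
    using Suc by auto
  moreover have "g j < g i"
    using assms(2)[of j i] j Suc by simp
  ultimately show ?case
    using Suc.hyps by simp
qed

text \<open>Counting predecessors already represents \<open>L\<close>, but the counts may leave
  gaps. Ranking each count within the set of all counts closes them and makes the levels an initial
  segment.\<close>

lemma strict_weak_order_level:
  assumes "finite A"
    and irrefl: "\<And>i. i \<in> A \<Longrightarrow> \<not> L i i"
    and trans: "\<And>i j k. i \<in> A \<Longrightarrow> j \<in> A \<Longrightarrow> k \<in> A \<Longrightarrow> L i j \<Longrightarrow> L j k \<Longrightarrow> L i k"
    and neg_trans: "\<And>i j k. i \<in> A \<Longrightarrow> j \<in> A \<Longrightarrow> k \<in> A \<Longrightarrow> L i k \<Longrightarrow> L i j \<or> L j k"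
  obtains f :: "'a \<Rightarrow> nat" and k
    where "f \<in> surjections A {..<k}" "\<And>i j. i \<in> A \<Longrightarrow> j \<in> A \<Longrightarrow> L i j \<longleftrightarrow> f i < f j"
proof -
  define g where "g i = card {j \<in> A. L j i}" for i
  have g: "L i j \<longleftrightarrow> g i < g j" if "i \<in> A" "j \<in> A" for i j
  proof
    assume "L i j"
    \<comment> \<open>The inclusion is transitivity; it is strict because \<open>i\<close> lies in
      the right-hand set and, by irreflexivity, not in the left-hand one.\<close>
    then have "{l \<in> A. L l i} \<subset> {l \<in> A. L l j}"
      using that irrefl trans by blast
    then show "g i < g j"
      unfolding g_def using assms(1) by (simp add: psubset_card_mono)
  next
    assume less: "g i < g j"
    show "L i j"
    proof (rule ccontr)
      assume "\<not> L i j"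
      \<comment> \<open>Negative transitivity splits \<open>L l j\<close> into \<open>L l i\<close>
        or \<open>L i j\<close>, and the latter is excluded.\<close>
      then have "{l \<in> A. L l j} \<subseteq> {l \<in> A. L l i}"
        using that neg_trans by blast
      then have "g j \<le> g i"
        unfolding g_def using assms(1) by (simp add: card_mono)
      with less show False by simp
    qed
  qed
  define f where "f = restrict (\<lambda>i. card {y \<in> g ` A. y < g i}) A"
  have fin: "finite (g ` A)"
    using assms(1) by simp
  have mono: "card {y \<in> g ` A. y < u} < card {y \<in> g ` A. y < v}" if "u \<in> g ` A" "u < v" for u v
    using that fin by (intro psubset_card_mono) auto
  have f: "f i < f j \<longleftrightarrow> g i < g j" if "i \<in> A" "j \<in> A" for i j
    using that mono[of "g i" "g j"] mono[of "g j" "g i"]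
    by (cases "g i" "g j" rule: linorder_cases) (auto simp: f_def)
  have sub: "f ` A \<subseteq> {..<card (g ` A)}"
  proof safe
    fix i assume i: "i \<in> A"
    have "card {y \<in> g ` A. y < g i} < card (g ` A)"
      using i fin by (intro psubset_card_mono) auto
    then show "f i < card (g ` A)"
      using i by (simp add: f_def)
  qed
  have "inj_on (\<lambda>u. card {y \<in> g ` A. y < u}) (g ` A)"
  proof (rule inj_onI)
    fix u v assume "u \<in> g ` A" "v \<in> g ` A" "card {y \<in> g ` A. y < u} = card {y \<in> g ` A. y < v}"
    then show "u = v"
      using mono[of u v] mono[of v u] by (cases u v rule: linorder_cases) simp_all
  qed
  then have "card (f ` A) = card (g ` A)"
    using card_image[of "\<lambda>u. card {y \<in> g ` A. y < u}" "g ` A"] by (simp add: f_def image_image)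
  then have "f ` A = {..<card (g ` A)}"
    using sub by (intro card_subset_eq) auto
  then have "f \<in> surjections A {..<card (g ` A)}"
    by (simp add: surjections_def f_def)
  with that g f show thesis by blast
qed

definition level_map :: "nat \<Rightarrow> 'c \<Rightarrow> 'c \<Rightarrow> nat \<times> (nat \<Rightarrow> nat) \<times> nat set \<Rightarrow> nat \<times> nat \<Rightarrow> 'c" where
  "level_map n a b = (\<lambda>(k, f, E). restrict
     (\<lambda>(i, j). if f i < f j \<or> f i = f j \<and> f i \<in> E then a else b) ({1..n} \<times> {1..n}))"

text \<open>For a fixed number \<open>k\<close> of levels, the choices of \<open>f\<close> and of
  \<open>E\<close> account for the factors \<open>Stirling n k * fact k\<close> and
  \<open>2 ^ k\<close> of the summand in \<open>B_num n\<close>.\<close>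

definition level_codes :: "nat \<Rightarrow> (nat \<times> (nat \<Rightarrow> nat) \<times> nat set) set" where
  "level_codes n = (SIGMA k:{1..n}. surjections {1..n} {..<k} \<times> Pow {..<k})"

lemma card_level_codes: "card (level_codes n) = B_num n"
proof -
  have "card (level_codes n) = (\<Sum>k = 1..n. card (surjections {1..n} {..<k}) * 2 ^ k)"
    unfolding level_codes_def
    by (subst card_SigmaI) (auto simp: finite_surjections card_cartesian_product card_Pow)
  also have "\<dots> = B_num n"
    unfolding B_num_def by (intro sum.cong refl) (simp add: card_surjections mult_ac)
  finally show ?thesis .
qed

lemma level_map_apply:
  assumes "i \<in> {1..n}" "j \<in> {1..n}"
  shows "level_map n a b (k, f, E) (i, j) = (if f i < f j \<or> f i = f j \<and> f i \<in> E then a else b)"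
  using assms by (simp add: level_map_def)

text \<open>If \<open>f i < f k\<close>, then \<open>f i < f j\<close> or \<open>f j < f k\<close>,
  so one of the two steps through \<open>j\<close> has value \<open>a\<close>; dually for
  \<open>f k < f i\<close> and \<open>b\<close>. If \<open>f i = f k\<close>, then \<open>j\<close>
  on the same level gives the same value, and \<open>j\<close> on another level gives one step with
  \<open>a\<close> and one with \<open>b\<close>.\<close>

lemma level_map_in_transitive_maps: "level_map n a b p \<in> transitive_maps n {a, b}"
proof -
  obtain k f E where p: "p = (k, f, E)"
    by (cases p) auto
  have "level_map n a b p \<in> ({1..n} \<times> {1..n}) \<rightarrow>\<^sub>E {a, b}"
    by (auto simp: p level_map_def)
  moreover have "transitive_map n (level_map n a b p)"
    unfolding transitive_map_def p by (simp add: level_map_def) (metis less_trans linorder_neqE_nat)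
  ultimately show ?thesis
    by (simp add: transitive_maps_def)
qed

text \<open>The strict comparisons of levels can be read off from the pairs of values at
  \<open>(i, j)\<close> and \<open>(j, i)\<close>. They determine \<open>f\<close>, whose image
  determines \<open>k\<close>; the diagonal values then determine \<open>E\<close>.\<close>

lemma inj_on_level_map:
  assumes "a \<noteq> b"
  shows "inj_on (level_map n a b) (level_codes n)"
proof (rule inj_onI)
  fix p q
  assume p: "p \<in> level_codes n" and q: "q \<in> level_codes n"
    and eq: "level_map n a b p = level_map n a b q"
  obtain k f E where pf: "p = (k, f, E)" by (cases p) auto
  obtain k' f' E' where qf: "q = (k', f', E')" by (cases q) auto
  have f: "f \<in> extensional {1..n}" "f ` {1..n} = {..<k}" "E \<subseteq> {..<k}"
    and f': "f' \<in> extensional {1..n}" "f' ` {1..n} = {..<k'}" "E' \<subseteq> {..<k'}"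
    using p q by (auto simp: pf qf level_codes_def surjections_def)
  have less: "f i < f j \<longleftrightarrow> f' i < f' j" if "i \<in> {1..n}" "j \<in> {1..n}" for i j
  proof -
    have "g i < g j \<longleftrightarrow> level_map n a b (l, g, F) (i, j) = a \<and> level_map n a b (l, g, F) (j, i) = b"
      for l F and g :: "nat \<Rightarrow> nat"
      using assms by (auto simp: level_map_apply[OF that] level_map_apply[OF that(2,1)])
    then show ?thesis
      using eq unfolding pf qf by metis
  qed
  have "f i = f' i" if "i \<in> {1..n}" for i
    using surjection_le_of_order_preserving[OF f(2), of f' i]
      surjection_le_of_order_preserving[OF f'(2), of f i] less that by force
  then have ff': "f = f'"
    using f(1) f'(1) by (auto intro: extensionalityI)
  then have kk': "k = k'"
    using f(2) f'(2) by (metis card_lessThan)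
  have "f i \<in> E \<longleftrightarrow> f i \<in> E'" if "i \<in> {1..n}" for i
    using fun_cong[OF eq, of "(i, i)"] that assms by (auto simp: pf qf ff' level_map_apply split: if_splits)
  moreover have "E \<subseteq> f ` {1..n}" "E' \<subseteq> f ` {1..n}"
    using f f' ff' by auto
  ultimately have "E = E'"
    by blast
  with ff' kk' show "p = q"
    by (simp add: pf qf)
qed

lemma transitive_map_cases:
  assumes "transitive_map n c" "i \<in> {1..n}" "j \<in> {1..n}" "k \<in> {1..n}"
  shows "c (i, k) = c (i, j) \<or> c (i, k) = c (j, k)"
  using assms unfolding transitive_map_def by blast

lemma transitive_maps_subset_level_maps:
  assumes "a \<noteq> b" "n \<ge> 1"
  shows "transitive_maps n {a, b} \<subseteq> level_map n a b ` level_codes n"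
proof
  fix c assume c: "c \<in> transitive_maps n {a, b}"
  let ?A = "{1..n}"
  have tr: "transitive_map n c" and cE: "c \<in> (?A \<times> ?A) \<rightarrow>\<^sub>E {a, b}"
    using c by (auto simp: transitive_maps_def)
  note t = transitive_map_cases[OF tr]
  have ab: "c (i, j) = b \<longleftrightarrow> c (i, j) \<noteq> a" if "i \<in> ?A" "j \<in> ?A" for i j
    using PiE_mem[OF cE, of "(i, j)"] that assms by auto
  \<comment> \<open>With \<open>c (j, i) \<noteq> a\<close> in place of \<open>c (j, i) = b\<close>,
    irreflexivity is immediate for every index, also outside \<open>{1..n}\<close>.\<close>
  define L where "L i j \<longleftrightarrow> c (i, j) = a \<and> c (j, i) \<noteq> a" for i j
  \<comment> \<open>If both alternatives fail, one of the pairs \<open>i, j\<close> and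
    \<open>j, k\<close> has value \<open>a\<close> in both directions and the other has
    \<open>b\<close>. In the first case \<open>c (j, i) = a\<close> although \<open>c (j, k)\<close>
    and \<open>c (k, i)\<close> are \<open>b\<close>; in the second \<open>c (k, j) = a\<close>
    although \<open>c (k, i)\<close> and \<open>c (i, j)\<close> are \<open>b\<close>.\<close>
  have L_neg_trans: "L i j \<or> L j k" if "i \<in> ?A" "j \<in> ?A" "k \<in> ?A" "L i k" for i j k
    using that t[of i j k] t[of k j i] t[of j i k] t[of j k i] t[of i k j] t[of k i j]
    unfolding L_def by (smt (verit) ab)
  have L_trans: "L i k" if "i \<in> ?A" "j \<in> ?A" "k \<in> ?A" "L i j" "L j k" for i j k
    using that t[of i j k] t[of k j i] t[of j i k] t[of j k i] t[of i k j] t[of k i j]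
    unfolding L_def by (smt (verit) ab)
  obtain f :: "nat \<Rightarrow> nat" and k where f: "f \<in> surjections ?A {..<k}"
    and fL: "\<And>i j. i \<in> ?A \<Longrightarrow> j \<in> ?A \<Longrightarrow> L i j \<longleftrightarrow> f i < f j"
  proof (rule strict_weak_order_level[of ?A L])
    show "\<not> L i i" for i
      by (simp add: L_def)
    show "L i k" if "i \<in> ?A" "j \<in> ?A" "k \<in> ?A" "L i j" "L j k" for i j k
      using L_trans that by blast
    show "L i j \<or> L j k" if "i \<in> ?A" "j \<in> ?A" "k \<in> ?A" "L i k" for i j k
      using L_neg_trans that by blast
  qed simp_all
  define E where "E = f ` {i \<in> ?A. c (i, i) = a}"
  \<comment> \<open>On a level \<open>c\<close> is symmetric, as unequal values would be an
    \<open>L\<close>-comparison. Transitivity from \<open>u\<close> through \<open>v\<close> back to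
    \<open>u\<close> then equates diagonal and off-diagonal values, so membership in
    \<open>E\<close> does not depend on the chosen element of the level.\<close>
  have tie: "c (i, j) = c (l, l)" if "i \<in> ?A" "j \<in> ?A" "l \<in> ?A" "f i = f j" "f l = f i" for i j l
  proof -
    have sym: "c (u, v) = c (v, u)" if "u \<in> ?A" "v \<in> ?A" "f u = f v" for u v
      using fL[of u v] fL[of v u] ab[of u v] ab[of v u] that unfolding L_def by metis
    have diag: "c (u, u) = c (u, v)" if "u \<in> ?A" "v \<in> ?A" "f u = f v" for u v
      using sym[of u v] t[of u v u] that by auto
    show ?thesis
      using diag[of i j] diag[of i l] diag[of l i] sym[of i l] that by simp
  qed
  have "c = level_map n a b (k, f, E)"
  proof (rule extensionalityI[of _ "?A \<times> ?A"])
    show "c \<in> extensional (?A \<times> ?A)"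
      using cE by (simp add: PiE_def)
    show "level_map n a b (k, f, E) \<in> extensional (?A \<times> ?A)"
      by (simp add: level_map_def)
    fix p assume "p \<in> ?A \<times> ?A"
    then obtain i j where p: "p = (i, j)" and ij: "i \<in> ?A" "j \<in> ?A"
      by auto
    consider "f i < f j" | "f j < f i" | "f i = f j"
      by linarith
    then show "c p = level_map n a b (k, f, E) p"
    proof cases
      case 1
      then show ?thesis
        using fL[of i j] ij by (simp add: p level_map_apply L_def)
    next
      case 2
      then show ?thesis
        using fL[of j i] ij ab[of i j] by (simp add: p level_map_apply L_def)
    next
      case 3
      have "f i \<in> E \<longleftrightarrow> c (i, j) = a"
      proof
        assume "f i \<in> E"
        then obtain l where "f i = f l" "l \<in> {i \<in> ?A. c (i, i) = a}"
          unfolding E_def by (rule imageE)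
        then show "c (i, j) = a"
          using tie[OF ij _ 3, of l] by simp
      next
        assume "c (i, j) = a"
        then have "c (i, i) = a"
          using tie[OF ij ij(1) 3 refl] by simp
        then show "f i \<in> E"
          unfolding E_def using ij(1) by blast
      qed
      then show ?thesis
        using 3 ij ab[of i j] by (simp add: p level_map_apply)
    qed
  qed
  moreover have "(k, f, E) \<in> level_codes n"
  proof -
    have im: "f ` ?A = {..<k}"
      using f by (simp add: surjections_def)
    have "k \<le> n"
      using card_image_le[of ?A f] unfolding im by simp
    moreover have "f ` ?A \<noteq> {}"
      using assms(2) by simp
    then have "k \<noteq> 0"
      unfolding im by auto
    moreover have "E \<subseteq> {..<k}"
      using im by (auto simp: E_def)
    ultimately show ?thesis
      using f by (auto simp: level_codes_def)
  qed
  ultimately show "c \<in> level_map n a b ` level_codes n"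
    by blast
qed

lemma card_transitive_maps_two:
  assumes "a \<noteq> b" "n \<ge> 1"
  shows "card (transitive_maps n {a, b}) = B_num n"
proof -
  have "transitive_maps n {a, b} = level_map n a b ` level_codes n"
    by (intro equalityI transitive_maps_subset_level_maps[OF assms] image_subsetI
        level_map_in_transitive_maps)
  then show ?thesis
    using inj_on_level_map[OF assms(1)] by (simp add: card_image card_level_codes)
qed

section \<open>Maps constant along rows or along columns, by inclusion-exclusion\<close>

section \<open>Maps that depend on one argument\<close>

definition fst_map :: "nat \<Rightarrow> (nat \<times> nat \<Rightarrow> 'c) \<Rightarrow> bool" where
  "fst_map n c \<longleftrightarrow> (\<forall>i\<in>{1..n}. \<forall>j\<in>{1..n}. \<forall>k\<in>{1..n}. c (i, j) = c (i, k))"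

definition snd_map :: "nat \<Rightarrow> (nat \<times> nat \<Rightarrow> 'c) \<Rightarrow> bool" where
  "snd_map n c \<longleftrightarrow> (\<forall>i\<in>{1..n}. \<forall>j\<in>{1..n}. \<forall>k\<in>{1..n}. c (i, k) = c (j, k))"

lemma fst_map_transitive: "fst_map n c \<Longrightarrow> transitive_map n c"
  unfolding fst_map_def transitive_map_def by blast

lemma snd_map_transitive: "snd_map n c \<Longrightarrow> transitive_map n c"
  unfolding snd_map_def transitive_map_def by blast

lemma restrict_prod_eq:
  assumes "c \<in> (A \<times> B) \<rightarrow>\<^sub>E C" "\<And>i j. i \<in> A \<Longrightarrow> j \<in> B \<Longrightarrow> g (i, j) = c (i, j)"
  shows "restrict g (A \<times> B) = c"
  by (rule extensionalityI[of _ "A \<times> B"]) (use assms in \<open>auto simp: PiE_iff\<close>)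

text \<open>Such a map is determined by its first column, which exists as \<open>n \<ge> 1\<close>
  and may be any function into \<open>C\<close>.\<close>

lemma card_fst_maps:
  assumes "n \<ge> 1"
  shows "card {c \<in> ({1..n} \<times> {1..n}) \<rightarrow>\<^sub>E C. fst_map n c} = card C ^ n"
proof -
  have "bij_betw (\<lambda>f. restrict (\<lambda>(i, j). f i) ({1..n} \<times> {1..n})) ({1..n} \<rightarrow>\<^sub>E C)
      {c \<in> ({1..n} \<times> {1..n}) \<rightarrow>\<^sub>E C. fst_map n c}"
  proof (rule bij_betw_byWitness[where f' = "\<lambda>c. restrict (\<lambda>i. c (i, 1)) {1..n}"])
    show "\<forall>f\<in>{1..n} \<rightarrow>\<^sub>E C. restrict (\<lambda>i. restrict (\<lambda>(i, j). f i) ({1..n} \<times> {1..n}) (i, 1)) {1..n} = f"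
      using assms by (auto simp: PiE_iff intro!: extensionalityI[of _ "{1..n}"])
    show "\<forall>c\<in>{c \<in> ({1..n} \<times> {1..n}) \<rightarrow>\<^sub>E C. fst_map n c}.
        restrict (\<lambda>(i, j). restrict (\<lambda>i. c (i, 1)) {1..n} i) ({1..n} \<times> {1..n}) = c"
    proof safe
      fix c assume c: "c \<in> ({1..n} \<times> {1..n}) \<rightarrow>\<^sub>E C" "fst_map n c"
      have eq: "c (i, 1) = c (i, j)" if "i \<in> {1..n}" "j \<in> {1..n}" for i j
        using c(2) that assms unfolding fst_map_def by (meson atLeastAtMost_iff order_refl)
      show "restrict (\<lambda>(i, j). restrict (\<lambda>i. c (i, 1)) {1..n} i) ({1..n} \<times> {1..n}) = c"
        by (rule restrict_prod_eq[OF c(1)]) (simp only: prod.case restrict_apply', rule eq)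
    qed
    show "(\<lambda>f. restrict (\<lambda>(i, j). f i) ({1..n} \<times> {1..n})) ` ({1..n} \<rightarrow>\<^sub>E C)
        \<subseteq> {c \<in> ({1..n} \<times> {1..n}) \<rightarrow>\<^sub>E C. fst_map n c}"
      by (auto simp: fst_map_def split: if_splits)
    show "(\<lambda>c. restrict (\<lambda>i. c (i, 1)) {1..n}) ` {c \<in> ({1..n} \<times> {1..n}) \<rightarrow>\<^sub>E C. fst_map n c}
        \<subseteq> {1..n} \<rightarrow>\<^sub>E C"
      using assms by auto
  qed
  from bij_betw_same_card[OF this] show ?thesis
    by (simp add: card_funcsetE)
qed

lemma card_snd_maps:
  assumes "n \<ge> 1"
  shows "card {c \<in> ({1..n} \<times> {1..n}) \<rightarrow>\<^sub>E C. snd_map n c} = card C ^ n"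
proof -
  have "bij_betw (\<lambda>f. restrict (\<lambda>(i, j). f j) ({1..n} \<times> {1..n})) ({1..n} \<rightarrow>\<^sub>E C)
      {c \<in> ({1..n} \<times> {1..n}) \<rightarrow>\<^sub>E C. snd_map n c}"
  proof (rule bij_betw_byWitness[where f' = "\<lambda>c. restrict (\<lambda>i. c (1, i)) {1..n}"])
    show "\<forall>f\<in>{1..n} \<rightarrow>\<^sub>E C. restrict (\<lambda>i. restrict (\<lambda>(i, j). f j) ({1..n} \<times> {1..n}) (1, i)) {1..n} = f"
      using assms by (auto simp: PiE_iff intro!: extensionalityI[of _ "{1..n}"])
    show "\<forall>c\<in>{c \<in> ({1..n} \<times> {1..n}) \<rightarrow>\<^sub>E C. snd_map n c}.
        restrict (\<lambda>(i, j). restrict (\<lambda>i. c (1, i)) {1..n} j) ({1..n} \<times> {1..n}) = c"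
    proof safe
      fix c assume c: "c \<in> ({1..n} \<times> {1..n}) \<rightarrow>\<^sub>E C" "snd_map n c"
      have eq: "c (1, j) = c (i, j)" if "i \<in> {1..n}" "j \<in> {1..n}" for i j
        using c(2) that assms unfolding snd_map_def by (meson atLeastAtMost_iff order_refl)
      show "restrict (\<lambda>(i, j). restrict (\<lambda>i. c (1, i)) {1..n} j) ({1..n} \<times> {1..n}) = c"
        by (rule restrict_prod_eq[OF c(1)]) (simp only: prod.case restrict_apply', rule eq)
    qed
    show "(\<lambda>f. restrict (\<lambda>(i, j). f j) ({1..n} \<times> {1..n})) ` ({1..n} \<rightarrow>\<^sub>E C)
        \<subseteq> {c \<in> ({1..n} \<times> {1..n}) \<rightarrow>\<^sub>E C. snd_map n c}"
      by (auto simp: snd_map_def split: if_splits)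
    show "(\<lambda>c. restrict (\<lambda>i. c (1, i)) {1..n}) ` {c \<in> ({1..n} \<times> {1..n}) \<rightarrow>\<^sub>E C. snd_map n c}
        \<subseteq> {1..n} \<rightarrow>\<^sub>E C"
      using assms by auto
  qed
  from bij_betw_same_card[OF this] show ?thesis
    by (simp add: card_funcsetE)
qed

lemma fst_snd_map_const:
  assumes "fst_map n c" "snd_map n c" "i \<in> {1..n}" "j \<in> {1..n}" "u \<in> {1..n}" "v \<in> {1..n}"
  shows "c (i, j) = c (u, v)"
  using assms unfolding fst_map_def snd_map_def by metis

lemma card_fst_snd_maps:
  assumes "n \<ge> 1"
  shows "card {c \<in> ({1..n} \<times> {1..n}) \<rightarrow>\<^sub>E C. fst_map n c \<and> snd_map n c} = card C"
proof -
  have "bij_betw (\<lambda>x. restrict (\<lambda>_. x) ({1..n} \<times> {1..n})) C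
      {c \<in> ({1..n} \<times> {1..n}) \<rightarrow>\<^sub>E C. fst_map n c \<and> snd_map n c}"
  proof (rule bij_betw_byWitness[where f' = "\<lambda>c. c (1, 1)"])
    show "\<forall>c\<in>{c \<in> ({1..n} \<times> {1..n}) \<rightarrow>\<^sub>E C. fst_map n c \<and> snd_map n c}.
        restrict (\<lambda>_. c (1, 1)) ({1..n} \<times> {1..n}) = c"
    proof safe
      fix c assume c: "c \<in> ({1..n} \<times> {1..n}) \<rightarrow>\<^sub>E C" "fst_map n c" "snd_map n c"
      have "c (1, 1) = c (i, j)" if "i \<in> {1..n}" "j \<in> {1..n}" for i j
        using fst_snd_map_const[OF c(2,3), of 1 1 i j] that assms by simp
      then show "restrict (\<lambda>_. c (1, 1)) ({1..n} \<times> {1..n}) = c"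
        by (rule restrict_prod_eq[OF c(1)])
    qed
    show "(\<lambda>x. restrict (\<lambda>_. x) ({1..n} \<times> {1..n})) ` C
        \<subseteq> {c \<in> ({1..n} \<times> {1..n}) \<rightarrow>\<^sub>E C. fst_map n c \<and> snd_map n c}"
      by (auto simp: fst_map_def snd_map_def split: if_splits)
  qed (use assms in auto)
  from bij_betw_same_card[OF this] show ?thesis
    by simp
qed

text \<open>Inclusion-exclusion, where the maps in the intersection are the constant ones. The
  additive form avoids truncated subtraction.\<close>

lemma card_fst_or_snd_maps:
  assumes "n \<ge> 1" "finite C"
  shows "card {c \<in> ({1..n} \<times> {1..n}) \<rightarrow>\<^sub>E C. fst_map n c \<or> snd_map n c} + card C = 2 * card C ^ n"
proof -
  let ?X = "{c \<in> ({1..n} \<times> {1..n}) \<rightarrow>\<^sub>E C. fst_map n c}"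
  let ?Y = "{c \<in> ({1..n} \<times> {1..n}) \<rightarrow>\<^sub>E C. snd_map n c}"
  have "finite ?X" "finite ?Y"
    using assms(2) by (simp_all add: finite_Collect_PiE)
  from card_Un_Int[OF this]
  have "card ?X + card ?Y = card (?X \<union> ?Y) + card (?X \<inter> ?Y)" .
  moreover have "?X \<union> ?Y = {c \<in> ({1..n} \<times> {1..n}) \<rightarrow>\<^sub>E C. fst_map n c \<or> snd_map n c}"
    by blast
  moreover have "?X \<inter> ?Y = {c \<in> ({1..n} \<times> {1..n}) \<rightarrow>\<^sub>E C. fst_map n c \<and> snd_map n c}"
    by blast
  ultimately show ?thesis
    using card_fst_maps[OF assms(1), of C] card_snd_maps[OF assms(1), of C]
      card_fst_snd_maps[OF assms(1), of C]
    by (simp add: mult_2)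
qed

section \<open>Transitive maps depending on both arguments take exactly two values\<close>

section \<open>The remaining maps\<close>

lemma transitive_map_row_determines:
  assumes "transitive_map n c" "i \<in> {1..n}" "x \<in> {1..n}" "y \<in> {1..n}" "c (i, x) \<noteq> c (i, y)"
  shows "c (x, y) = c (i, y)"
  using transitive_map_cases[OF assms(1), of i x y] assms by auto

text \<open>Where row \<open>i\<close> differs at \<open>x\<close> and \<open>y\<close>, this is
  \<open>transitive_map_row_determines\<close>. Where it agrees, the other two values of the row
  give two different bounds on \<open>c (x, y)\<close>, with only \<open>c (i, y)\<close> in
  common.\<close>

lemma transitive_map_row_three_values:
  assumes tr: "transitive_map n c" and i: "i \<in> {1..n}"
    and uvw: "u \<in> {1..n}" "v \<in> {1..n}" "w \<in> {1..n}"
    and ne: "c (i, u) \<noteq> c (i, v)" "c (i, u) \<noteq> c (i, w)" "c (i, v) \<noteq> c (i, w)"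
    and xy: "x \<in> {1..n}" "y \<in> {1..n}"
  shows "c (x, y) = c (i, y)"
proof (cases "c (i, x) = c (i, y)")
  case False
  then show ?thesis
    using transitive_map_row_determines[OF tr i xy] by simp
next
  case True
  \<comment> \<open>Row \<open>i\<close> differs at \<open>x\<close> and \<open>z\<close> and at
    \<open>z\<close> and \<open>y\<close>, so both steps of the path from \<open>x\<close> through
    \<open>z\<close> to \<open>y\<close> are known.\<close>
  have *: "c (x, y) = c (i, y) \<or> c (x, y) = c (i, z)" if "z \<in> {1..n}" "c (i, z) \<noteq> c (i, y)" for z
    using transitive_map_row_determines[OF tr i xy(1) that(1)]
      transitive_map_row_determines[OF tr i that(1) xy(2)]
      transitive_map_cases[OF tr xy(1) that(1) xy(2)] that True by auto
  show ?thesis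
    using *[OF uvw(1)] *[OF uvw(2)] *[OF uvw(3)] ne by metis
qed

text \<open>A value missing from row \<open>i\<close> would spread into column \<open>i\<close>, at
  \<open>u\<close> and at some \<open>z\<close> where row \<open>i\<close> has another value than at
  \<open>u\<close>. Then \<open>c (i, i)\<close>, which is not the missing value either, would have
  to equal both \<open>c (i, u)\<close> and \<open>c (i, z)\<close>.\<close>

lemma transitive_map_value_in_row:
  assumes tr: "transitive_map n c" and i: "i \<in> {1..n}"
    and xy: "x \<in> {1..n}" "y \<in> {1..n}" and ne: "c (i, x) \<noteq> c (i, y)"
    and uv: "u \<in> {1..n}" "v \<in> {1..n}"
  shows "\<exists>w\<in>{1..n}. c (i, w) = c (u, v)"
proof (rule ccontr)
  assume "\<not> ?thesis"
  then have nd: "c (i, w) \<noteq> c (u, v)" if "w \<in> {1..n}" for w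
    using that by blast
  obtain z where z: "z \<in> {1..n}" "c (i, z) \<noteq> c (i, u)"
    using xy ne by metis
  note t = transitive_map_cases[OF tr]
  have "c (u, i) = c (u, v)"
    using t[of u i v] nd[of v] i uv by metis
  moreover have "c (u, z) = c (i, z)"
    using transitive_map_row_determines[OF tr i uv(1) z(1)] z(2) by metis
  moreover have "c (z, i) = c (u, v)"
    using t[of u z i] calculation nd[of z] i uv z by metis
  moreover have "c (i, i) = c (i, u)" "c (i, i) = c (i, z)"
    using t[of i u i] t[of i z i] calculation nd[of i] i uv z by metis+
  ultimately show False
    using z by metis
qed

text \<open>Failure of \<open>fst_map\<close> supplies a row with two values; a third value anywhere
  would make all rows equal and so contradict the failure of \<open>snd_map\<close>.\<close>

lemma transitive_map_at_most_two_values: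
  assumes tr: "transitive_map n c" and "\<not> fst_map n c" "\<not> snd_map n c"
  obtains a b where "a \<noteq> b" "c ` ({1..n} \<times> {1..n}) = {a, b}"
proof -
  obtain i x y where i: "i \<in> {1..n}" and xy: "x \<in> {1..n}" "y \<in> {1..n}"
    and ne: "c (i, x) \<noteq> c (i, y)"
    using assms(2) unfolding fst_map_def by blast
  have "c (u, v) = c (i, x) \<or> c (u, v) = c (i, y)" if uv: "u \<in> {1..n}" "v \<in> {1..n}" for u v
  proof (rule ccontr)
    assume neq: "\<not> ?thesis"
    obtain w where w: "w \<in> {1..n}" "c (i, w) = c (u, v)"
      using transitive_map_value_in_row[OF tr i xy ne uv] by blast
    have "c (r, s) = c (i, s)" if "r \<in> {1..n}" "s \<in> {1..n}" for r s
      by (rule transitive_map_row_three_values[OF tr i xy w(1) ne _ _ that]) (use neq w in auto)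
    then have "snd_map n c"
      unfolding snd_map_def by metis
    with assms(3) show False by simp
  qed
  then have "c ` ({1..n} \<times> {1..n}) \<subseteq> {c (i, x), c (i, y)}"
    by blast
  moreover have "c (i, x) \<in> c ` ({1..n} \<times> {1..n})" "c (i, y) \<in> c ` ({1..n} \<times> {1..n})"
    using i xy by blast+
  ultimately have "c ` ({1..n} \<times> {1..n}) = {c (i, x), c (i, y)}"
    by blast
  with ne that show thesis by blast
qed

section \<open>Counting the maps that depend on both arguments by their value sets\<close>

definition mixed_maps :: "nat \<Rightarrow> 'c set \<Rightarrow> (nat \<times> nat \<Rightarrow> 'c) set" where
  "mixed_maps n C = {c \<in> transitive_maps n C. \<not> fst_map n c \<and> \<not> snd_map n c}"

lemma finite_transitive_maps: "finite C \<Longrightarrow> finite (transitive_maps n C)"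
  unfolding transitive_maps_def by (simp add: finite_Collect_PiE)

lemma finite_mixed_maps: "finite C \<Longrightarrow> finite (mixed_maps n C)"
  by (simp add: mixed_maps_def finite_transitive_maps)

lemma card_transitive_maps:
  assumes "n \<ge> 1" "finite C"
  shows "card (transitive_maps n C) + card C = 2 * card C ^ n + card (mixed_maps n C)"
proof -
  let ?X = "{c \<in> ({1..n} \<times> {1..n}) \<rightarrow>\<^sub>E C. fst_map n c \<or> snd_map n c}"
  have "transitive_maps n C = ?X \<union> mixed_maps n C"
    by (auto simp: transitive_maps_def mixed_maps_def fst_map_transitive snd_map_transitive)
  moreover have "?X \<inter> mixed_maps n C = {}"
    by (auto simp: mixed_maps_def)
  moreover have "finite ?X" "finite (mixed_maps n C)"
    using assms(2) by (simp_all add: finite_Collect_PiE finite_mixed_maps)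
  ultimately have "card (transitive_maps n C) = card ?X + card (mixed_maps n C)"
    by (simp add: card_Un_disjoint)
  then show ?thesis
    using card_fst_or_snd_maps[OF assms] by simp
qed

text \<open>Exactly two values inside a two-element set exhaust it. Hence a mixed map recovers
  \<open>D\<close>, which makes the union over two-element subsets of \<open>C\<close>
  disjoint.\<close>

lemma mixed_maps_image:
  assumes "c \<in> mixed_maps n D" "card D = 2"
  shows "c ` ({1..n} \<times> {1..n}) = D"
proof -
  have c: "transitive_map n c" "\<not> fst_map n c" "\<not> snd_map n c"
    and sub: "c ` ({1..n} \<times> {1..n}) \<subseteq> D"
    using assms(1) by (auto simp: mixed_maps_def transitive_maps_def)
  obtain a b where "a \<noteq> b" and "c ` ({1..n} \<times> {1..n}) = {a, b}"
    using transitive_map_at_most_two_values[OF c] .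
  then have "card (c ` ({1..n} \<times> {1..n})) = 2"
    by simp
  moreover have "finite D"
    using assms(2) by (metis card.infinite zero_neq_numeral)
  ultimately show ?thesis
    using sub assms(2) by (intro card_subset_eq) auto
qed

lemma mixed_maps_eq_Union:
  "mixed_maps n C = (\<Union>D\<in>{D. D \<subseteq> C \<and> card D = 2}. mixed_maps n D)"
proof
  show "mixed_maps n C \<subseteq> (\<Union>D\<in>{D. D \<subseteq> C \<and> card D = 2}. mixed_maps n D)"
  proof
    fix c assume c: "c \<in> mixed_maps n C"
    then have m: "transitive_map n c" "\<not> fst_map n c" "\<not> snd_map n c"
      and cE: "c \<in> ({1..n} \<times> {1..n}) \<rightarrow>\<^sub>E C"
      by (auto simp: mixed_maps_def transitive_maps_def)
    obtain a b where ab: "a \<noteq> b" and im: "c ` ({1..n} \<times> {1..n}) = {a, b}"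
      using transitive_map_at_most_two_values[OF m] .
    have "c \<in> ({1..n} \<times> {1..n}) \<rightarrow>\<^sub>E {a, b}"
      using cE im by (auto simp: PiE_def simp flip: image_subset_iff_funcset)
    then have "c \<in> mixed_maps n {a, b}"
      using m by (simp add: mixed_maps_def transitive_maps_def)
    moreover have "c ` ({1..n} \<times> {1..n}) \<subseteq> C"
      using cE by auto
    then have "{a, b} \<subseteq> C"
      by (simp only: im)
    moreover have "card {a, b} = 2"
      using ab by simp
    ultimately show "c \<in> (\<Union>D\<in>{D. D \<subseteq> C \<and> card D = 2}. mixed_maps n D)"
      by blast
  qed
  show "(\<Union>D\<in>{D. D \<subseteq> C \<and> card D = 2}. mixed_maps n D) \<subseteq> mixed_maps n C"
    by (auto simp: mixed_maps_def transitive_maps_def PiE_iff)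
qed

text \<open>Comparing the direct count \<open>B_num n\<close> with the decomposition in
  \<open>card_transitive_maps\<close> at two values isolates the mixed maps; their number is the
  same for every \<open>D\<close>.\<close>

lemma card_mixed_maps_two:
  assumes "n \<ge> 1" "card D = 2"
  shows "card (mixed_maps n D) + 2 * 2 ^ n = B_num n + 2"
proof -
  obtain a b where D: "D = {a, b}" "a \<noteq> b"
    using assms(2) by (auto simp: card_2_iff)
  have "card (transitive_maps n D) + card D = 2 * card D ^ n + card (mixed_maps n D)"
    by (rule card_transitive_maps[OF assms(1)]) (simp add: D)
  moreover have "card (transitive_maps n D) = B_num n"
    unfolding D(1) by (rule card_transitive_maps_two[OF D(2) assms(1)])
  ultimately show ?thesis
    unfolding assms(2) by simp
qed

text \<open>Each of the \<open>card C choose 2\<close> possible value sets contributes equally. Over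
  the reals the contribution can be written as a difference.\<close>

lemma card_mixed_maps:
  assumes "n \<ge> 1" "finite C"
  shows "real (card (mixed_maps n C)) =
    real (card C choose 2) * (real (B_num n) + 2 - 2 * 2 ^ n)"
proof -
  let ?P = "{D. D \<subseteq> C \<and> card D = 2}"
  have "card (mixed_maps n C) = (\<Sum>D\<in>?P. card (mixed_maps n D))"
    unfolding mixed_maps_eq_Union[of n C]
  proof (rule card_UN_disjoint)
    show "finite ?P"
      using assms(2) by simp
    show "\<forall>D\<in>?P. finite (mixed_maps n D)"
      using assms(2) by (auto intro: finite_mixed_maps finite_subset)
    show "\<forall>D\<in>?P. \<forall>E\<in>?P. D \<noteq> E \<longrightarrow> mixed_maps n D \<inter> mixed_maps n E = {}"
    proof (intro ballI impI)
      fix D E assume DE: "D \<in> ?P" "E \<in> ?P" and "D \<noteq> E"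
      have False if "c \<in> mixed_maps n D" "c \<in> mixed_maps n E" for c
        using mixed_maps_image[OF that(1)] mixed_maps_image[OF that(2)] DE \<open>D \<noteq> E\<close> by simp
      then show "mixed_maps n D \<inter> mixed_maps n E = {}"
        by blast
    qed
  qed
  then have "real (card (mixed_maps n C)) = (\<Sum>D\<in>?P. real (card (mixed_maps n D)))"
    by simp
  also have "\<dots> = (\<Sum>D\<in>?P. real (B_num n) + 2 - 2 * 2 ^ n)"
  proof (rule sum.cong[OF refl])
    fix D assume "D \<in> ?P"
    then have "card D = 2"
      by simp
    have "real (card (mixed_maps n D) + 2 * 2 ^ n) = real (B_num n + 2)"
      unfolding card_mixed_maps_two[OF assms(1) \<open>card D = 2\<close>] ..
    then show "real (card (mixed_maps n D)) = real (B_num n) + 2 - 2 * 2 ^ n"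
      by simp
  qed
  also have "\<dots> = real (card C choose 2) * (real (B_num n) + 2 - 2 * 2 ^ n)"
    using n_subsets[OF assms(2)] by simp
  finally show ?thesis .
qed

lemma real_choose_two: "real (m choose 2) = real m * (real m - 1) / 2"
proof (induction m)
  case (Suc m)
  then show ?case
    by (simp add: numeral_2_eq_2 field_simps)
qed simp

lemma card_transitive_maps_eq_q_fun:
  assumes "n \<ge> 1" "finite C"
  shows "real (card (transitive_maps n C)) = q_fun n (real (card C))"
proof -
  have "real (card (transitive_maps n C) + card C) = real (2 * card C ^ n + card (mixed_maps n C))"
    using card_transitive_maps[OF assms] by simp
  then show ?thesis
    \<comment> \<open>The 1/2 from the binomial coefficient turns
      \<open>B_num n + 2 - 2 * 2 ^ n\<close> into the coefficient of \<open>x * (x - 1)\<close> in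
      \<open>q_fun\<close>.\<close>
    by (simp add: card_mixed_maps[OF assms] real_choose_two q_fun_def field_simps)
qed

theorem corollary3p20:
  fixes n :: nat and C :: "'c set"
  assumes "n \<ge> 2" and "finite C"
  shows "real (card (transitive_maps n C)) = q_fun n (real (card C)) \<and>
         real (card (transitive_maps n {1, -1 :: int})) = q_fun n 2 \<and>
         q_fun n 2 = real (B_num n)"
proof -
  have n: "n \<ge> 1"
    using assms(1) by simp
  have "real (card (transitive_maps n {1, -1 :: int})) = q_fun n 2"
    using card_transitive_maps_eq_q_fun[OF n, of "{1, -1 :: int}"] by simp
  \<comment> \<open>Counting the same set directly yields \<open>q_fun n 2 = B_num n\<close> without
    evaluating the polynomial.\<close>
  moreover have "card (transitive_maps n {1, -1 :: int}) = B_num n"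
    using n by (intro card_transitive_maps_two) auto
  ultimately show ?thesis
    using card_transitive_maps_eq_q_fun[OF n assms(2)] by simp
qed

end
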